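(* Assume the initial box $\mathcal{U}'_{poly}(0)$ contains the SDP-relaxed dispatchable region $\mathcal{U}'$. In any run of the polytopic approximation algorithm described in the context, for every iteration $c$ the polytope $\mathcal{U}'_{poly}(c)$ produced by the algorithm is an outer approximation of $\mathcal{U}'$, i.e. $\mathcal{U}'\subseteq\mathcal{U}'_{poly}(c)$. Moreover the approximation improves as $c$ increases, i.e. $\mathcal{U}'\subseteq\mathcal{U}'_{poly}(c+1)\subseteq\mathcal{U}'_{poly}(c)$ for every iteration $c$ for which $\mathcal{U}'_{poly}(c+1)$ is produced.
   Context: Network. Let $N\ge 1$ and let $\mathcal{G}=(\mathcal{V},\mathcal{E})$ be a tree on the buses $\mathcal{V}=\{0,1,\dots,N\}$; bus $0$ is the slack (root) bus and $\mathcal{N}^+=\{1,\dots,N\}$. Write $j\sim k$ if $(j,k)\in\mathcal{E}$. Phases $\phi\in\{a,b,c\}$ are identified with $1,2,3$. Each line $(j,k)$ has a series admittance matrix $\mathbf{y}_{jk}=\mathbf{y}_{kj}\in\mathbb{C}^{3\times3}$. For a $3(N+1)\times 3(N+1)$ matrix $\mathbf{X}$, $[\mathbf{X}]_{jk}$ is the $3\times3$ block with rows $3j+1,\dots,3j+3$ and columns $3k+1,\dots,3k+3$. The admittance matrix $\mathbf{Y}\in\mathbb{C}^{3(N+1)\times3(N+1)}$ has blocks $[\mathbf{Y}]_{jj}=\sum_{k:k\sim j}\mathbf{y}_{jk}$, $[\mathbf{Y}]_{jk}=-\mathbf{y}_{jk}$ if $j\sim k$, and $[\mathbf{Y}]_{jk}=0$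 if $j\ne k$, $j\nsim k$. Let $\mathbf{e}_j^\phi\in\mathbb{R}^{3(N+1)}$ be the standard basis vector with $1$ in entry $3j+\phi$, $\mathbf{E}_j^\phi=\mathbf{e}_j^\phi(\mathbf{e}_j^\phi)^{\sf T}$, $\mathbf{Y}_j^\phi=\mathbf{E}_j^\phi\mathbf{Y}$, $\bm{\mathcal{P}}_j^\phi=\frac12((\mathbf{Y}_j^\phi)^{\sf H}+\mathbf{Y}_j^\phi)$, $\bm{\mathcal{Q}}_j^\phi=\frac1{2i}((\mathbf{Y}_j^\phi)^{\sf H}-\mathbf{Y}_j^\phi)$ (with $i$ the imaginary unit). Data. Given real constants $\underline{p}_j^\phi\le\overline{p}_j^\phi$, $\underline{q}_j^\phi\le\overline{q}_j^\phi$, $0\le\underline{V}_j^\phi\le\overline{V}_j^\phi$ for $j\in\mathcal{N}^+$ and each $\phi$, put $\underline{v}_j^\phi=(\underline{V}_j^\phi)^2$, $\overline{v}_j^\phi=(\overline{V}_j^\phi)^2$. The slack voltage $\mathbf{V}_{\rm ref}\in\mathbb{C}^3$ is fixed and $\bm{v}_{\rm ref}=\mathbf{V}_{\rm ref}\mathbf{V}_{\rm ref}^{\sf H}$. A subset $\mathcal{N}_U\subseteq\mathcal{N}^+$ of $U=|\mathcal{N}_U|$ buses has renewable generation; $\mathbf{u}\in\mathbb{R}^{3U}$ has entries $u_j^\phi$, $j\in\mathcal{N}_U$, and $u_j^\phi:=0$ for $j\notin\mathcal{N}_U$. Matrices that are $\succeq0$ are Hermitian positive semidefinite. Primal SDP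 FP$'(\mathbf{u})$: minimize $\sum_{k=1}^6\sum_{j\in\mathcal{N}^+,\phi}z_{kj}^\phi$ over Hermitian $\mathbf{W}\succeq0$ of size $3(N+1)$ and $z_{kj}^\phi\ge0$ subject to, for all $j\in\mathcal{N}^+$ and $\phi$: $\mathrm{tr}(\bm{\mathcal{P}}_j^\phi\mathbf{W})-u_j^\phi-\overline{p}_j^\phi\le z_{1j}^\phi$; $-\mathrm{tr}(\bm{\mathcal{P}}_j^\phi\mathbf{W})+u_j^\phi+\underline{p}_j^\phi\le z_{2j}^\phi$; $\mathrm{tr}(\bm{\mathcal{Q}}_j^\phi\mathbf{W})-\overline{q}_j^\phi\le z_{3j}^\phi$; $-\mathrm{tr}(\bm{\mathcal{Q}}_j^\phi\mathbf{W})+\underline{q}_j^\phi\le z_{4j}^\phi$; $\mathrm{tr}(\mathbf{E}_j^\phi\mathbf{W})-\overline{v}_j^\phi\le z_{5j}^\phi$; $-\mathrm{tr}(\mathbf{E}_j^\phi\mathbf{W})+\underline{v}_j^\phi\le z_{6j}^\phi$; and $[\mathbf{W}]_{00}=\bm{v}_{\rm ref}$. Its optimal value is $\mathrm{fp}'(\mathbf{u})$, and the SDP-relaxed dispatchable region is $\mathcal{U}'=\{\mathbf{u}\in\mathbb{R}^{3U}_{\ge0}: \mathrm{fp}'(\mathbf{u})=0\}$. Dual SDP DP$'(\mathbf{u})$: maximize $$D_{\mathbf{u}}(\bm\lambda,\bm\alpha)=\sum_{j\in\mathcal{N}^+,\phi}\Big((\lambda_{2j}^\phi-\lambda_{1j}^\phi)u_j^\phi-\lambda_{1j}^\phi\overline{p}_j^\phi+\lambda_{2j}^\phi\underline{p}_j^\phi-\lambda_{3j}^\phi\overline{q}_j^\phi+\lambda_{4j}^\phi\underline{q}_j^\phi-\lambda_{5j}^\phi\overline{v}_j^\phi+\lambda_{6j}^\phi\underline{v}_j^\phi\Big)-\mathrm{tr}(\bm\alpha\bm{v}_{\rm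 ref})$$ over $0\le\lambda_{kj}^\phi\le1$ ($k=1,\dots,6$) and $\bm\alpha\in\mathbb{C}^{3\times3}$ subject to $\mathbf{A}(\bm\lambda,\bm\alpha)\succeq0$, where $\mathbf{A}(\bm\lambda,\bm\alpha)=\bm\Pi(\bm\alpha)+\sum_{j\in\mathcal{N}^+,\phi}\big((\lambda_{1j}^\phi-\lambda_{2j}^\phi)\bm{\mathcal{P}}_j^\phi+(\lambda_{3j}^\phi-\lambda_{4j}^\phi)\bm{\mathcal{Q}}_j^\phi+(\lambda_{5j}^\phi-\lambda_{6j}^\phi)\mathbf{E}_j^\phi\big)$ and $\bm\Pi(\bm\alpha)$ has top-left $3\times3$ block $\bm\alpha$ and all other entries $0$. Its optimal value is $\mathrm{dp}'(\mathbf{u})$. Algorithm. Inputs: a box $\mathcal{U}'_{poly}(0)=\{\mathbf{u}\in\mathbb{R}^{3U}_{\ge0}:\underline{u}\le u_j^\phi\le\overline{u}\}$, a threshold $\epsilon>0$, a maximum iteration count $C_{\max}$. Initially $\mathcal{V}_{safe}=\varnothing$, $c=0$, $\mathrm{dp}'_{\max}[0]=99$. While $\mathrm{dp}'_{\max}[c]>\epsilon$ and $c<C_{\max}$: set $\mathcal{U}'_{poly}(c+1)=\mathcal{U}'_{poly}(c)$ and $\mathrm{dp}'_{\max}[c+1]=-1$; for each vertex $\mathbf{u}$ of $\mathcal{U}'_{poly}(c)$ not in $\mathcal{V}_{safe}$, solve DP$'(\mathbf{u})$ to get an optimal solution $(\bm\lambda_{\max},\bm\alpha_{\max})$ and value $\mathrm{dp}'(\mathbf{u})$;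 if $\mathrm{dp}'(\mathbf{u})\le\epsilon$, add $\mathbf{u}$ to $\mathcal{V}_{safe}$; otherwise intersect $\mathcal{U}'_{poly}(c+1)$ with the half-space of points $\mathbf{u}'$ satisfying $D_{\mathbf{u}'}(\bm\lambda_{\max},\bm\alpha_{\max})\le0$ (with $(\bm\lambda_{\max},\bm\alpha_{\max})$ fixed), and set $\mathrm{dp}'_{\max}[c+1]=\max(\mathrm{dp}'_{\max}[c+1],\mathrm{dp}'(\mathbf{u}))$. Then increase $c$ by $1$. At termination return $\mathcal{U}'_{poly}(c)$. *)

theory Defs
  imports "HOL-Analysis.Analysis"
begin

text \<open>
  The buses are the elements of a finite type \<open>'b\<close> with one distinguished slack bus, so
  \<open>CARD('b) = N + 1\<close>, and the phases \<open>a, b, c\<close> are the elements of the numeral type \<open>3\<close>.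
  A matrix of size \<open>3(N+1)\<close> is indexed by pairs (bus, phase); the pair \<open>(j, \<phi>)\<close> plays the role of
  the position \<open>3j + \<phi>\<close>.
\<close>

type_synonym 'b bmat = "complex^('b \<times> 3)^('b \<times> 3)"

definition ctranspose :: "complex^'m^'n \<Rightarrow> complex^'n^'m" where
  "ctranspose M = map_matrix cnj (transpose M)"

definition psd :: "complex^'n^'n \<Rightarrow> bool" where
  "psd M \<longleftrightarrow> ctranspose M = M \<and>
    (\<forall>x :: complex^'n. 0 \<le> Re (\<Sum>i\<in>UNIV. cnj (x $ i) * (M *v x) $ i))"

definition block :: "'b::finite bmat \<Rightarrow> 'b \<Rightarrow> 'b \<Rightarrow> complex^3^3" where
  "block M j k = (\<chi> \<phi> \<psi>. M $ (j, \<phi>) $ (k, \<psi>))"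

text \<open>
  A tree whose vertices are all elements of the type, given by its symmetric adjacency relation.
  (The directed notion \<open>tree\<close> of the AFP entry Graph\_Theory does not fit: there an undirected edge,
  represented by two opposite arcs, already is a cycle.)
\<close>

definition is_tree :: "('b \<times> 'b) set \<Rightarrow> bool" where
  "is_tree E \<longleftrightarrow> sym E \<and> irrefl E \<and> (\<forall>j k. (j, k) \<in> E\<^sup>*) \<and>
    \<not> (\<exists>p. 3 \<le> length p \<and> distinct p \<and>
          (\<forall>i. Suc i < length p \<longrightarrow> (p ! i, p ! Suc i) \<in> E) \<and> (last p, hd p) \<in> E)"

record 'b network =
  slack :: 'b
  lines :: "('b \<times> 'b) set"
  adm :: "'b \<Rightarrow> 'b \<Rightarrow> complex^3^3"
  p_min :: "'b \<Rightarrow> 3 \<Rightarrow> real"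
  p_max :: "'b \<Rightarrow> 3 \<Rightarrow> real"
  q_min :: "'b \<Rightarrow> 3 \<Rightarrow> real"
  q_max :: "'b \<Rightarrow> 3 \<Rightarrow> real"
  V_min :: "'b \<Rightarrow> 3 \<Rightarrow> real"
  V_max :: "'b \<Rightarrow> 3 \<Rightarrow> real"
  V_ref :: "complex^3"
  renewables :: "'b set"

definition nonslack :: "'b network \<Rightarrow> 'b set" where
  "nonslack G = UNIV - {slack G}"

definition valid_network :: "'b::finite network \<Rightarrow> bool" where
  "valid_network G \<longleftrightarrow>
    CARD('b) \<ge> 2 \<and>
    is_tree (lines G) \<and>
    (\<forall>(j, k) \<in> lines G. adm G j k = adm G k j) \<and>
    (\<forall>j \<in> nonslack G. \<forall>\<phi>. p_min G j \<phi> \<le> p_max G j \<phi> \<and> q_min G j \<phi> \<le> q_max G j \<phi> \<and>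
        0 \<le> V_min G j \<phi> \<and> V_min G j \<phi> \<le> V_max G j \<phi>) \<and>
    renewables G \<subseteq> nonslack G"

definition v_min :: "'b network \<Rightarrow> 'b \<Rightarrow> 3 \<Rightarrow> real" where
  "v_min G j \<phi> = (V_min G j \<phi>)\<^sup>2"

definition v_max :: "'b network \<Rightarrow> 'b \<Rightarrow> 3 \<Rightarrow> real" where
  "v_max G j \<phi> = (V_max G j \<phi>)\<^sup>2"

definition v_ref :: "'b network \<Rightarrow> complex^3^3" where
  "v_ref G = (\<chi> \<phi> \<psi>. V_ref G $ \<phi> * cnj (V_ref G $ \<psi>))"

definition Ymat :: "'b::finite network \<Rightarrow> 'b bmat" where
  "Ymat G = (\<chi> r c. case (r, c) of ((j, \<phi>), (k, \<psi>)) \<Rightarrow>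
      (if j = k then (\<Sum>l | (j, l) \<in> lines G. adm G j l) $ \<phi> $ \<psi>
       else if (j, k) \<in> lines G then - adm G j k $ \<phi> $ \<psi>
       else 0))"

definition Emat :: "'b::finite \<Rightarrow> 3 \<Rightarrow> 'b bmat" where
  "Emat j \<phi> = (let e = axis (j, \<phi>) 1 in (\<chi> r c. e $ r * e $ c))"

definition Yrow :: "'b::finite network \<Rightarrow> 'b \<Rightarrow> 3 \<Rightarrow> 'b bmat" where
  "Yrow G j \<phi> = Emat j \<phi> ** Ymat G"

definition Pmat :: "'b::finite network \<Rightarrow> 'b \<Rightarrow> 3 \<Rightarrow> 'b bmat" where
  "Pmat G j \<phi> = map_matrix ((*) (1 / 2)) (ctranspose (Yrow G j \<phi>) + Yrow G j \<phi>)"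

definition Qmat :: "'b::finite network \<Rightarrow> 'b \<Rightarrow> 3 \<Rightarrow> 'b bmat" where
  "Qmat G j \<phi> = map_matrix ((*) (1 / (2 * \<i>))) (ctranspose (Yrow G j \<phi>) - Yrow G j \<phi>)"

text \<open>
  The space of generation vectors \<open>u\<close>, of dimension \<open>3U\<close>, is the coordinate subspace of
  \<open>real^3^'b\<close> in which \<open>u\<^sub>j = 0\<close> for all buses \<open>j\<close> without renewable generation.
\<close>

definition gen_space :: "'b::finite network \<Rightarrow> (real^3^'b) set" where
  "gen_space G = {u. \<forall>j. j \<notin> renewables G \<longrightarrow> u $ j = 0}"

text \<open>
  All traces below are real at feasible points, because the matrices involved are Hermitian;
  \<open>Re\<close> only adjusts the type. The optimal values are taken in the extended reals.
\<close>

definition fp_feasible ::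
  "'b::finite network \<Rightarrow> real^3^'b \<Rightarrow> 'b bmat \<Rightarrow> (nat \<Rightarrow> 'b \<Rightarrow> 3 \<Rightarrow> real) \<Rightarrow> bool" where
  "fp_feasible G u W z \<longleftrightarrow>
    psd W \<and> block W (slack G) (slack G) = v_ref G \<and>
    (\<forall>j \<in> nonslack G. \<forall>\<phi>.
      (\<forall>k \<in> {1..6}. 0 \<le> z k j \<phi>) \<and>
      Re (trace (Pmat G j \<phi> ** W)) - u $ j $ \<phi> - p_max G j \<phi> \<le> z 1 j \<phi> \<and>
      - Re (trace (Pmat G j \<phi> ** W)) + u $ j $ \<phi> + p_min G j \<phi> \<le> z 2 j \<phi> \<and>
      Re (trace (Qmat G j \<phi> ** W)) - q_max G j \<phi> \<le> z 3 j \<phi> \<and>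
      - Re (trace (Qmat G j \<phi> ** W)) + q_min G j \<phi> \<le> z 4 j \<phi> \<and>
      Re (trace (Emat j \<phi> ** W)) - v_max G j \<phi> \<le> z 5 j \<phi> \<and>
      - Re (trace (Emat j \<phi> ** W)) + v_min G j \<phi> \<le> z 6 j \<phi>)"

definition fp_value :: "'b::finite network \<Rightarrow> real^3^'b \<Rightarrow> ereal" where
  "fp_value G u = (INF (W, z) \<in> {(W, z). fp_feasible G u W z}.
      ereal (\<Sum>k = 1..6. \<Sum>j \<in> nonslack G. \<Sum>\<phi> \<in> UNIV. z k j \<phi>))"

definition dispatchable_region :: "'b::finite network \<Rightarrow> (real^3^'b) set" where
  "dispatchable_region G =
    {u \<in> gen_space G. (\<forall>j \<phi>. 0 \<le> u $ j $ \<phi>) \<and> fp_value G u = 0}"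

definition Pimat :: "'b::finite network \<Rightarrow> complex^3^3 \<Rightarrow> 'b bmat" where
  "Pimat G \<alpha> = (\<chi> r c. case (r, c) of ((j, \<phi>), (k, \<psi>)) \<Rightarrow>
      (if j = slack G \<and> k = slack G then \<alpha> $ \<phi> $ \<psi> else 0))"

definition Amat ::
  "'b::finite network \<Rightarrow> (nat \<Rightarrow> 'b \<Rightarrow> 3 \<Rightarrow> real) \<Rightarrow> complex^3^3 \<Rightarrow> 'b bmat" where
  "Amat G l \<alpha> = Pimat G \<alpha> + (\<Sum>j \<in> nonslack G. \<Sum>\<phi> \<in> UNIV.
      (l 1 j \<phi> - l 2 j \<phi>) *\<^sub>R Pmat G j \<phi> +
      (l 3 j \<phi> - l 4 j \<phi>) *\<^sub>R Qmat G j \<phi> +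
      (l 5 j \<phi> - l 6 j \<phi>) *\<^sub>R Emat j \<phi>)"

definition dp_feasible ::
  "'b::finite network \<Rightarrow> (nat \<Rightarrow> 'b \<Rightarrow> 3 \<Rightarrow> real) \<Rightarrow> complex^3^3 \<Rightarrow> bool" where
  "dp_feasible G l \<alpha> \<longleftrightarrow>
    (\<forall>k \<in> {1..6}. \<forall>j \<in> nonslack G. \<forall>\<phi>. 0 \<le> l k j \<phi> \<and> l k j \<phi> \<le> 1) \<and>
    psd (Amat G l \<alpha>)"

definition dual_objective ::
  "'b::finite network \<Rightarrow> real^3^'b \<Rightarrow> (nat \<Rightarrow> 'b \<Rightarrow> 3 \<Rightarrow> real) \<Rightarrow> complex^3^3 \<Rightarrow> real" where
  "dual_objective G u l \<alpha> =
    (\<Sum>j \<in> nonslack G. \<Sum>\<phi> \<in> UNIV.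
      (l 2 j \<phi> - l 1 j \<phi>) * u $ j $ \<phi>
      - l 1 j \<phi> * p_max G j \<phi> + l 2 j \<phi> * p_min G j \<phi>
      - l 3 j \<phi> * q_max G j \<phi> + l 4 j \<phi> * q_min G j \<phi>
      - l 5 j \<phi> * v_max G j \<phi> + l 6 j \<phi> * v_min G j \<phi>)
    - Re (trace (\<alpha> ** v_ref G))"

definition dp_value :: "'b::finite network \<Rightarrow> real^3^'b \<Rightarrow> ereal" where
  "dp_value G u = (SUP (l, \<alpha>) \<in> {(l, \<alpha>). dp_feasible G l \<alpha>}. ereal (dual_objective G u l \<alpha>))"

definition dp_optimal ::
  "'b::finite network \<Rightarrow> real^3^'b \<Rightarrow> (nat \<Rightarrow> 'b \<Rightarrow> 3 \<Rightarrow> real) \<Rightarrow> complex^3^3 \<Rightarrow> bool" where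
  "dp_optimal G u l \<alpha> \<longleftrightarrow> dp_feasible G l \<alpha> \<and> ereal (dual_objective G u l \<alpha>) = dp_value G u"

definition initial_box :: "'b::finite network \<Rightarrow> real \<Rightarrow> real \<Rightarrow> (real^3^'b) set" where
  "initial_box G u_lo u_hi = {u \<in> gen_space G.
     \<forall>j \<in> renewables G. \<forall>\<phi>. 0 \<le> u $ j $ \<phi> \<and> u_lo \<le> u $ j $ \<phi> \<and> u $ j $ \<phi> \<le> u_hi}"

record 'b alg_state =
  v_safe :: "(real^3^'b) set"
  upoly :: "(real^3^'b) set"
  dp_max :: ereal

definition initial_state :: "'b::finite network \<Rightarrow> real \<Rightarrow> real \<Rightarrow> 'b alg_state" where
  "initial_state G u_lo u_hi = \<lparr>v_safe = {}, upoly = initial_box G u_lo u_hi, dp_max = 99\<rparr>"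

text \<open>
  \<open>process_vertices G \<epsilon> us s s'\<close>: executing the body of the inner loop for the vertices in the
  list \<open>us\<close>, in this order, can transform \<open>s\<close> into \<open>s'\<close>. Here \<open>upoly\<close> and \<open>dp_max\<close> are the
  polytope and the maximum with index \<open>c + 1\<close> under construction. The relation is
  nondeterministic, since the dual problem may have several optimal solutions.
\<close>

inductive process_vertices ::
  "'b::finite network \<Rightarrow> real \<Rightarrow> (real^3^'b) list \<Rightarrow> 'b alg_state \<Rightarrow> 'b alg_state \<Rightarrow> bool"
  for G :: "'b network" and \<epsilon> :: real where
  finish: "process_vertices G \<epsilon> [] s s"
| keep: "\<lbrakk>dp_optimal G u l \<alpha>; dp_value G u \<le> ereal \<epsilon>;
    process_vertices G \<epsilon> us (s\<lparr>v_safe := insert u (v_safe s)\<rparr>) s'\<rbrakk>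
    \<Longrightarrow> process_vertices G \<epsilon> (u # us) s s'"
| cut: "\<lbrakk>dp_optimal G u l \<alpha>; dp_value G u > ereal \<epsilon>;
    process_vertices G \<epsilon> us
      (s\<lparr>upoly := upoly s \<inter> {u' \<in> gen_space G. dual_objective G u' l \<alpha> \<le> 0},
         dp_max := max (dp_max s) (dp_value G u)\<rparr>) s'\<rbrakk>
    \<Longrightarrow> process_vertices G \<epsilon> (u # us) s s'"

text \<open>
  One iteration of the outer loop; the vertices of a polytope are its extreme points, and they are
  visited in an arbitrary order.
\<close>

definition iteration ::
  "'b::finite network \<Rightarrow> real \<Rightarrow> 'b alg_state \<Rightarrow> 'b alg_state \<Rightarrow> bool" where
  "iteration G \<epsilon> s s' \<longleftrightarrow>
    (\<exists>us. distinct us \<and> set us = {u. u extreme_point_of upoly s \<and> u \<notin> v_safe s} \<and>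
          process_vertices G \<epsilon> us (s\<lparr>dp_max := -1\<rparr>) s')"

text \<open>
  \<open>s 0, \<dots>, s n\<close> are the states with index \<open>c = 0, \<dots>, n\<close> of a run in which \<open>n\<close> iterations
  have been carried out. Termination after \<open>n\<close> iterations is not required, so terminated runs are
  covered as well as their initial segments. The values of \<open>s\<close> beyond \<open>n\<close> are irrelevant.
\<close>

definition alg_run ::
  "'b::finite network \<Rightarrow> real \<Rightarrow> real \<Rightarrow> real \<Rightarrow> nat \<Rightarrow> nat \<Rightarrow> (nat \<Rightarrow> 'b alg_state) \<Rightarrow> bool" where
  "alg_run G u_lo u_hi \<epsilon> C_max n s \<longleftrightarrow>
    s 0 = initial_state G u_lo u_hi \<and>
    (\<forall>c < n. dp_max (s c) > ereal \<epsilon> \<and> c < C_max \<and> iteration G \<epsilon> (s c) (s (Suc c)))"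

end

theory Submission
  imports Defs
begin

text \<open>
  By weak duality every dual feasible point has objective at most \<open>fp_value G u\<close>, hence at most
  \<open>0\<close> when \<open>u\<close> is in the dispatchable region; so no cut removes a point of that region. Weak
  duality rests on \<open>tr (A W) \<ge> 0\<close> for positive semidefinite \<open>A\<close> and \<open>W\<close>, which is shown
  without a spectral theorem: subtracting from \<open>W\<close> a suitable rank-one positive semidefinite
  matrix (a Schur complement) clears one row and column and keeps \<open>W\<close> positive semidefinite.
\<close>

section \<open>Hermitian forms and the diagonal of a positive semidefinite matrix\<close>

definition herm_form :: "complex^'n^'n \<Rightarrow> complex^'n \<Rightarrow> complex^'n \<Rightarrow> complex" where
  "herm_form M x y = (\<Sum>i\<in>UNIV. cnj (x $ i) * (M *v y) $ i)"

lemma psd_iff: "psd M \<longleftrightarrow> ctranspose M = M \<and> (\<forall>x. 0 \<le> Re (herm_form M x x))"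
  by (simp add: psd_def herm_form_def)

lemma hermitian_entry: "ctranspose M = M \<Longrightarrow> cnj (M $ i $ j) = M $ j $ i"
  by (simp add: ctranspose_def transpose_def map_matrix_def vec_eq_iff)

lemma herm_form_axis_left: "herm_form M (axis a t) y = cnj t * (M *v y) $ a"
proof -
  have "herm_form M (axis a t) y = (\<Sum>i\<in>UNIV. if i = a then cnj t * (M *v y) $ i else 0)"
    unfolding herm_form_def by (intro sum.cong) (auto simp: axis_def)
  then show ?thesis by simp
qed

lemma herm_form_diff_left: "herm_form M (x - x') y = herm_form M x y - herm_form M x' y"
  by (simp add: herm_form_def algebra_simps sum_subtractf)

lemma herm_form_diff_right: "herm_form M x (y - y') = herm_form M x y - herm_form M x y'"
  by (simp add: herm_form_def matrix_vector_mult_diff_distrib algebra_simps sum_subtractf)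

lemma herm_form_commute:
  assumes "ctranspose M = M"
  shows "herm_form M x y = cnj (herm_form M y x)"
proof -
  have "herm_form M x y = (\<Sum>i\<in>UNIV. \<Sum>j\<in>UNIV. cnj (x $ i) * (M $ i $ j * y $ j))"
    by (simp add: herm_form_def matrix_vector_mult_def sum_distrib_left)
  also have "\<dots> = (\<Sum>j\<in>UNIV. \<Sum>i\<in>UNIV. cnj (x $ i) * (M $ i $ j * y $ j))"
    by (rule sum.swap)
  also have "\<dots> = cnj (herm_form M y x)"
    by (simp add: herm_form_def matrix_vector_mult_def sum_distrib_left hermitian_entry[OF assms]
        mult_ac)
  finally show ?thesis .
qed

text \<open>The two mixed terms are conjugate to each other, so they add up to twice a real part.
  The positivity arguments below differ only in their choice of \<open>x\<close> and
  \<open>t\<close> here.\<close>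

lemma Re_herm_form_diff_axis:
  assumes "ctranspose M = M"
  shows "Re (herm_form M (x - axis a t) (x - axis a t)) =
    Re (herm_form M x x) - 2 * Re (cnj t * (M *v x) $ a) + (cmod t)\<^sup>2 * Re (M $ a $ a)"
proof -
  have eq: "herm_form M (axis a t) (axis a t) = (cnj t * t) * M $ a $ a"
    by (simp add: herm_form_axis_left matrix_vector_mul_component inner_axis)
      (simp add: matrix_vector_mult_def axis_def if_distrib cong: if_cong)
  have tt: "cnj t * t = of_real ((cmod t)\<^sup>2)"
    by (simp only: complex_norm_square mult.commute)
  show ?thesis
    unfolding herm_form_diff_left herm_form_diff_right eq tt
    unfolding herm_form_commute[OF assms, of x "axis a t"] herm_form_axis_left
    by (simp del: of_real_power)
qed

lemma psd_diag:
  assumes "psd M"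
  shows "M $ a $ a = of_real (Re (M $ a $ a))" "0 \<le> Re (M $ a $ a)"
proof -
  have h: "ctranspose M = M" and p: "\<And>x. 0 \<le> Re (herm_form M x x)"
    using assms by (auto simp: psd_iff)
  show "M $ a $ a = of_real (Re (M $ a $ a))"
    using hermitian_entry[OF h, of a a] by (simp add: complex_eq_iff)
  show "0 \<le> Re (M $ a $ a)"
    using p[of "0 - axis a 1"] unfolding Re_herm_form_diff_axis[OF h]
    by (simp add: herm_form_def)
qed

text \<open>With a zero diagonal entry, the form at \<open>axis b 1 - axis a t\<close> is affine in
  \<open>t\<close>, so it stays nonnegative only if its slope \<open>M $ a $ b\<close>
  vanishes.\<close>

lemma psd_zero_diag_row:
  assumes "psd M" "M $ a $ a = 0"
  shows "M $ a $ b = 0"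
proof (rule ccontr)
  assume nz: "M $ a $ b \<noteq> 0"
  define w where "w = M $ a $ b"
  have h: "ctranspose M = M" and p: "\<And>x. 0 \<le> Re (herm_form M x x)"
    using assms by (auto simp: psd_iff)
  have row: "(M *v axis b 1) $ a = w"
    by (simp add: w_def matrix_vector_mult_def axis_def if_distrib cong: if_cong)
  define d where "d = Re (herm_form M (axis b 1) (axis b 1))"
  \<comment> \<open>Chosen so that the form at \<open>axis b 1 - axis a (of_real c * w)\<close>
    equals \<open>d - (d + 1) = -1\<close>.\<close>
  define c where "c = (d + 1) / (2 * (cmod w)\<^sup>2)"
  have "Re (cnj (of_real c * w) * w) = c * (cmod w)\<^sup>2"
    unfolding cmod_power2 by (simp add: power2_eq_square algebra_simps)
  moreover have "c * (cmod w)\<^sup>2 = (d + 1) / 2"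
    using nz by (simp add: c_def w_def)
  ultimately show False
    using p[of "axis b 1 - axis a (of_real c * w)"]
    unfolding Re_herm_form_diff_axis[OF h] row d_def[symmetric] by (simp add: assms(2))
qed

section \<open>Schur complements and the trace of a product\<close>

definition schur_complement :: "complex^'n^'n \<Rightarrow> 'n \<Rightarrow> complex^'n^'n" where
  "schur_complement M a = (\<chi> i j. M $ i $ j - M $ i $ a * M $ a $ j / M $ a $ a)"

text \<open>The form of the Schur complement at \<open>x\<close> is the minimum over
  \<open>t\<close> of the form of \<open>M\<close> at \<open>x - axis a t\<close>, hence
  nonnegative.\<close>

lemma psd_schur_complement:
  assumes "psd M" "M $ a $ a \<noteq> 0"
  shows "psd (schur_complement M a)"
proof -
  have h: "ctranspose M = M" and p: "\<And>x. 0 \<le> Re (herm_form M x x)"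
    using assms by (auto simp: psd_iff)
  define m where "m = Re (M $ a $ a)"
  have m: "M $ a $ a = of_real m" "m > 0"
    using psd_diag[OF assms(1), of a] assms(2) by (auto simp: m_def complex_eq_iff)
  have "ctranspose (schur_complement M a) = schur_complement M a"
    by (simp add: ctranspose_def schur_complement_def vec_eq_iff transpose_def
        map_matrix_def hermitian_entry[OF h] mult.commute)
  moreover have "0 \<le> Re (herm_form (schur_complement M a) x x)" for x
  proof -
    define w where "w = (M *v x) $ a"
    have mv: "(schur_complement M a *v x) $ i = (M *v x) $ i - M $ i $ a * w / of_real m" for i
      by (simp add: schur_complement_def matrix_vector_mult_def w_def m algebra_simps
          sum_subtractf sum_distrib_left sum_divide_distrib)
    have "(\<Sum>i\<in>UNIV. cnj (x $ i) * M $ i $ a) = cnj w"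
      by (simp add: w_def matrix_vector_mult_def hermitian_entry[OF h] mult.commute)
    moreover have "herm_form (schur_complement M a) x x =
        herm_form M x x - (\<Sum>i\<in>UNIV. cnj (x $ i) * M $ i $ a) * w / of_real m"
      by (simp add: herm_form_def mv algebra_simps sum_subtractf sum_distrib_left
          sum_divide_distrib)
    ultimately have "herm_form (schur_complement M a) x x =
        herm_form M x x - cnj w * w / of_real m"
      by simp
    also have "cnj w * w / of_real m = of_real ((cmod w)\<^sup>2 / m)"
      by (simp only: complex_norm_square mult.commute of_real_divide)
    finally have A: "Re (herm_form (schur_complement M a) x x) =
        Re (herm_form M x x) - (cmod w)\<^sup>2 / m" by simp
    \<comment> \<open>The minimum is attained at \<open>t = w / of_real m\<close>; here the linear
      and the quadratic term are evaluated there.\<close>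
    have "Re (cnj (w / of_real m) * w) = (cmod w)\<^sup>2 / m"
      unfolding cmod_power2 by (simp add: power2_eq_square add_divide_distrib)
    moreover have "(cmod (w / of_real m))\<^sup>2 * m = (cmod w)\<^sup>2 / m"
      using m(2) by (simp add: norm_divide power_divide power2_eq_square)
    ultimately have "Re (herm_form M x x) - 2 * ((cmod w)\<^sup>2 / m) + (cmod w)\<^sup>2 / m \<ge> 0"
      using p[of "x - axis a (w / of_real m)"]
      unfolding Re_herm_form_diff_axis[OF h] w_def[symmetric] m_def[symmetric] by linarith
    then show ?thesis using A by simp
  qed
  ultimately show ?thesis by (simp add: psd_iff)
qed

text \<open>The subtracted matrix is the column \<open>a\<close> times its conjugate transpose,
  divided by the pivot; by cyclicity its trace against \<open>A\<close> is the form of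
  \<open>A\<close> at that column.\<close>

lemma trace_schur_complement:
  assumes "ctranspose M = M"
  shows "trace (A ** M) = trace (A ** schur_complement M a)
    + herm_form A (column a M) (column a M) / M $ a $ a"
  by (simp add: trace_def matrix_matrix_mult_def schur_complement_def herm_form_def
      matrix_vector_mult_def column_def hermitian_entry[OF assms] algebra_simps
      sum_subtractf sum_distrib_left sum_divide_distrib)

lemma trace_psd_mult_nonneg:
  assumes "psd A" "psd M"
  shows "0 \<le> Re (trace (A ** M))"
proof -
  \<comment> \<open>Generalised for induction: \<open>S\<close> contains the indices of all nonzero
    rows, and each step removes one index.\<close>
  have "0 \<le> Re (trace (A ** M))"
    if "finite S" "psd M" "\<And>i j. M $ i $ j \<noteq> 0 \<Longrightarrow> i \<in> S" for S and M :: "complex^'a^'a"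
    using that
  proof (induction S arbitrary: M rule: finite_induct)
    case empty
    then have "M = 0" by (auto simp: vec_eq_iff)
    then show ?case by (simp add: trace_def)
  next
    case (insert a S)
    have h: "ctranspose M = M" using insert.prems by (simp add: psd_iff)
    show ?case
    proof (cases "M $ a $ a = 0")
      case True
      then have "M $ i $ j \<noteq> 0 \<Longrightarrow> i \<in> S" for i j
        using insert.prems psd_zero_diag_row[OF insert.prems(1) True] by blast
      then show ?thesis using insert.IH[OF insert.prems(1)] by blast
    next
      case False
      define m where "m = Re (M $ a $ a)"
      have m: "M $ a $ a = of_real m" "m \<ge> 0"
        using psd_diag[OF insert.prems(1), of a] by (auto simp: m_def)
      \<comment> \<open>Row \<open>a\<close> is cleared, and a row of \<open>M\<close> that was zero
        stays zero.\<close>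
      have "i \<in> S" if "schur_complement M a $ i $ j \<noteq> 0" for i j
      proof -
        have "i \<noteq> a" using that False by (auto simp: schur_complement_def)
        moreover have "M $ i $ j \<noteq> 0 \<or> M $ i $ a \<noteq> 0"
          using that by (auto simp: schur_complement_def)
        ultimately show ?thesis using insert.prems(2) by blast
      qed
      then have "0 \<le> Re (trace (A ** schur_complement M a))"
        using insert.IH psd_schur_complement[OF insert.prems(1) False] by blast
      moreover have "0 \<le> Re (herm_form A (column a M) (column a M))"
        using assms(1) by (simp add: psd_iff)
      ultimately show ?thesis
        unfolding trace_schur_complement[OF h, of A a] m(1) using m(2) by simp
    qed
  qed
  from this[of UNIV M] show ?thesis using assms by simp
qed

section \<open>Weak duality of the two semidefinite programs\<close>

lemma trace_mult_linear: "linear (\<lambda>M. Re (trace (M ** W)))"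
  for W :: "complex^'n^'n"
  by (rule linearI)
    (simp_all add: trace_def matrix_matrix_mult_def algebra_simps sum.distrib scaleR_sum_right
      sum_distrib_left)

lemma sum_UNIV_prod:
  "(\<Sum>x\<in>UNIV. f x) = (\<Sum>a\<in>UNIV. \<Sum>b\<in>UNIV. f (a, b))"
  by (simp add: sum.cartesian_product)

text \<open>Through this the primal constraint on the slack block turns into the last term of the
  dual objective.\<close>

lemma trace_Pimat_mult:
  "trace (Pimat G \<alpha> ** W) = trace (\<alpha> ** block W (slack G) (slack G))"
proof -
  have "trace (Pimat G \<alpha> ** W) = (\<Sum>j\<in>UNIV. \<Sum>\<phi>\<in>UNIV. \<Sum>k\<in>UNIV. \<Sum>\<psi>\<in>UNIV.
      Pimat G \<alpha> $ (j, \<phi>) $ (k, \<psi>) * W $ (k, \<psi>) $ (j, \<phi>))"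
    by (simp add: trace_def matrix_matrix_mult_def sum_UNIV_prod)
  also have "\<dots> = (\<Sum>j\<in>UNIV. \<Sum>\<phi>\<in>UNIV. \<Sum>k\<in>UNIV. if k = slack G then (if j = slack G then
      \<Sum>\<psi>\<in>UNIV. \<alpha> $ \<phi> $ \<psi> * W $ (k, \<psi>) $ (j, \<phi>) else 0) else 0)"
    by (intro sum.cong) (auto simp: Pimat_def)
  also have "\<dots> = (\<Sum>j\<in>UNIV. if j = slack G then
      \<Sum>\<phi>\<in>UNIV. \<Sum>\<psi>\<in>UNIV. \<alpha> $ \<phi> $ \<psi> * W $ (slack G, \<psi>) $ (j, \<phi>) else 0)"
    by (intro sum.cong) auto
  also have "\<dots> = trace (\<alpha> ** block W (slack G) (slack G))"
    by (simp add: trace_def matrix_matrix_mult_def block_def)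
  finally show ?thesis .
qed

text \<open>\<open>l * x \<le> l * z \<le> z\<close>; the upper bound 1 on the multipliers enters
  here.\<close>

lemma scale_le:
  fixes l x z :: real
  assumes "x \<le> z" "0 \<le> z" "0 \<le> l" "l \<le> 1"
  shows "l * x \<le> z"
  using mult_left_mono[OF assms(1,3)] mult_left_le_one_le[OF assms(2,3,4)] by linarith

text \<open>Adding \<open>Re (trace (Amat G l \<alpha> ** W)) \<ge> 0\<close> to the dual objective
  cancels the \<open>v_ref\<close> term and leaves the primal constraints weighted by their
  multipliers.\<close>

lemma sdp_weak_duality:
  assumes fp: "fp_feasible G u W z" and dp: "dp_feasible G l \<alpha>"
  shows "dual_objective G u l \<alpha> \<le> (\<Sum>k = 1..6. \<Sum>j\<in>nonslack G. \<Sum>\<phi>\<in>UNIV. z k j \<phi>)"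
proof -
  define T where "T M = Re (trace (M ** W))" for M
  have T: "linear T" unfolding T_def by (rule trace_mult_linear)
  have zs: "(\<Sum>k = 1..6. \<Sum>j\<in>nonslack G. \<Sum>\<phi>\<in>UNIV. z k j \<phi>) =
      (\<Sum>j\<in>nonslack G. \<Sum>\<phi>\<in>UNIV. z 1 j \<phi> + z 2 j \<phi> + z 3 j \<phi> + z 4 j \<phi> + z 5 j \<phi> + z 6 j \<phi>)"
    by (simp add: eval_nat_numeral sum.distrib)
  define t where "t j \<phi> = (l 1 j \<phi> - l 2 j \<phi>) * T (Pmat G j \<phi>)
    + (l 3 j \<phi> - l 4 j \<phi>) * T (Qmat G j \<phi>) + (l 5 j \<phi> - l 6 j \<phi>) * T (Emat j \<phi>)" for j \<phi>
  define d where "d j \<phi> = (l 2 j \<phi> - l 1 j \<phi>) * u $ j $ \<phi>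
      - l 1 j \<phi> * p_max G j \<phi> + l 2 j \<phi> * p_min G j \<phi>
      - l 3 j \<phi> * q_max G j \<phi> + l 4 j \<phi> * q_min G j \<phi>
      - l 5 j \<phi> * v_max G j \<phi> + l 6 j \<phi> * v_min G j \<phi>" for j \<phi>
  have "T (Amat G l \<alpha>) = T (Pimat G \<alpha>) + (\<Sum>j\<in>nonslack G. \<Sum>\<phi>\<in>UNIV. t j \<phi>)"
    by (simp add: Amat_def t_def linear_add[OF T] linear_sum[OF T] linear_cmul[OF T])
  moreover have "T (Pimat G \<alpha>) = Re (trace (\<alpha> ** v_ref G))"
    using fp by (simp add: T_def trace_Pimat_mult fp_feasible_def)
  moreover have "0 \<le> T (Amat G l \<alpha>)"
    unfolding T_def using fp dp
    by (intro trace_psd_mult_nonneg) (simp_all add: fp_feasible_def dp_feasible_def)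
  moreover have "(\<Sum>j\<in>nonslack G. \<Sum>\<phi>\<in>UNIV. d j \<phi> + t j \<phi>) \<le>
      (\<Sum>k = 1..6. \<Sum>j\<in>nonslack G. \<Sum>\<phi>\<in>UNIV. z k j \<phi>)"
    unfolding zs
  proof (intro sum_mono)
    fix j \<phi> assume j: "j \<in> nonslack G"
    have l: "0 \<le> l k j \<phi>" "l k j \<phi> \<le> 1" if "k \<in> {1..6}" for k
      using dp j that by (auto simp: dp_feasible_def)
    have z: "0 \<le> z k j \<phi>" if "k \<in> {1..6}" for k
      using fp j that by (auto simp: fp_feasible_def)
    have c: "T (Pmat G j \<phi>) - u $ j $ \<phi> - p_max G j \<phi> \<le> z 1 j \<phi>"
      "- T (Pmat G j \<phi>) + u $ j $ \<phi> + p_min G j \<phi> \<le> z 2 j \<phi>"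
      "T (Qmat G j \<phi>) - q_max G j \<phi> \<le> z 3 j \<phi>"
      "- T (Qmat G j \<phi>) + q_min G j \<phi> \<le> z 4 j \<phi>"
      "T (Emat j \<phi>) - v_max G j \<phi> \<le> z 5 j \<phi>"
      "- T (Emat j \<phi>) + v_min G j \<phi> \<le> z 6 j \<phi>"
      using fp j by (auto simp: fp_feasible_def T_def)
    \<comment> \<open>\<open>d j \<phi> + t j \<phi>\<close> is the sum of the six left-hand sides
      in \<open>c\<close>, each times its multiplier.\<close>
    show "d j \<phi> + t j \<phi> \<le> z 1 j \<phi> + z 2 j \<phi> + z 3 j \<phi> + z 4 j \<phi> + z 5 j \<phi> + z 6 j \<phi>"
      using scale_le[OF c(1) z l, of 1] scale_le[OF c(2) z l, of 2] scale_le[OF c(3) z l, of 3]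
        scale_le[OF c(4) z l, of 4] scale_le[OF c(5) z l, of 5] scale_le[OF c(6) z l, of 6]
      by (simp add: d_def t_def algebra_simps)
  qed
  ultimately show ?thesis
    unfolding dual_objective_def d_def[symmetric] sum.distrib by linarith
qed

text \<open>Weak duality passes to the infimum, which is infinite if no primal point is feasible.
  Dual feasibility does not involve \<open>u\<close>, so one dual point gives a bound for every
  \<open>u\<close>.\<close>

lemma dual_objective_le_fp_value:
  assumes "dp_feasible G l \<alpha>"
  shows "ereal (dual_objective G u l \<alpha>) \<le> fp_value G u"
  unfolding fp_value_def using sdp_weak_duality[OF _ assms]
  by (auto intro!: INF_greatest simp del: sum_ereal)

section \<open>Invariants of the algorithm\<close>

lemma process_vertices_subset:
  assumes "process_vertices G \<epsilon> us s s'"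
  shows "upoly s' \<subseteq> upoly s"
  using assms by induction auto

text \<open>The multipliers of a cut come from a vertex \<open>u\<close>, but they are dual feasible
  and so bound \<open>fp_value G u'\<close> from below at each \<open>u'\<close> of the region,
  where this value is 0.\<close>

lemma process_vertices_outer:
  assumes "process_vertices G \<epsilon> us s s'" "dispatchable_region G \<subseteq> upoly s"
  shows "dispatchable_region G \<subseteq> upoly s'"
  using assms
proof induction
  case (cut u l \<alpha> us s s')
  have "dispatchable_region G \<subseteq> {u' \<in> gen_space G. dual_objective G u' l \<alpha> \<le> 0}"
  proof
    fix u' assume "u' \<in> dispatchable_region G"
    then have "u' \<in> gen_space G" "fp_value G u' = 0"
      by (auto simp: dispatchable_region_def)
    then show "u' \<in> {u' \<in> gen_space G. dual_objective G u' l \<alpha> \<le> 0}"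
      using dual_objective_le_fp_value[of G l \<alpha> u'] cut.hyps(1)
      by (auto simp: dp_optimal_def zero_ereal_def)
  qed
  then show ?case using cut by simp
qed auto

theorem theorem1:
  fixes G :: "'b::finite network"
    and u_lo u_hi \<epsilon> :: real
    and C_max n :: nat
    and s :: "nat \<Rightarrow> 'b alg_state"
  assumes "valid_network G"
    and "\<epsilon> > 0"
    and "dispatchable_region G \<subseteq> initial_box G u_lo u_hi"
    and "alg_run G u_lo u_hi \<epsilon> C_max n s"
  shows "(\<forall>c \<le> n. dispatchable_region G \<subseteq> upoly (s c)) \<and>
         (\<forall>c < n. dispatchable_region G \<subseteq> upoly (s (Suc c)) \<and> upoly (s (Suc c)) \<subseteq> upoly (s c))"
proof -
  \<comment> \<open>Resetting \<open>dp_max\<close> leaves \<open>upoly\<close> unchanged, so both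
    invariants start from \<open>upoly (s c)\<close>.\<close>
  have step: "\<exists>us. process_vertices G \<epsilon> us (s c\<lparr>dp_max := -1\<rparr>) (s (Suc c))" if "c < n" for c
    using assms(4) that by (auto simp: alg_run_def iteration_def)
  have outer: "dispatchable_region G \<subseteq> upoly (s c)" if "c \<le> n" for c
    using that
  proof (induction c)
    case 0
    then show ?case using assms(3,4) by (simp add: alg_run_def initial_state_def)
  next
    case (Suc c)
    then show ?case using step[of c] process_vertices_outer by fastforce
  qed
  moreover have "upoly (s (Suc c)) \<subseteq> upoly (s c)" if "c < n" for c
    using step[OF that] process_vertices_subset by fastforce
  ultimately show ?thesis by (simp add: Suc_leI)
qed

end
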